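(* Let $\mathbb{C}_+=\{s\in\mathbb{C}:\operatorname{Re} s>0\}$. Given a function $f:\mathbb{C}_+\to\mathbb{C}$, the following are equivalent. (1) $f$ is the uniform limit on $\mathbb{C}_+$ of a sequence of Dirichlet polynomials. (2) $f$ is represented by a Dirichlet series pointwise on $\mathbb{C}_+$ (i.e. there are $a_n\in\mathbb{C}$, $n\ge 1$, such that $\sum_{n=1}^{\infty}\frac{a_n}{n^s}$ converges to $f(s)$ for every $s\in\mathbb{C}_+$) and $f$ is uniformly continuous on $\mathbb{C}_+$.
   Context: A Dirichlet polynomial is a function of the form $P(s)=\sum_{n=1}^{N}\frac{a_n}{n^s}$ with $N\in\mathbb{N}$ and $a_n\in\mathbb{C}$. A Dirichlet series is a series $\sum_{n=1}^\infty \frac{a_n}{n^s}$ with $a_n\in\mathbb{C}$. *)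

theory Defs
  imports "HOL-Analysis.Analysis"
begin

definition right_half_plane :: "complex set" where
  "right_half_plane = {s. Re s > 0}"

definition dirichlet_polynomial :: "(complex \<Rightarrow> complex) \<Rightarrow> bool" where
  "dirichlet_polynomial P \<longleftrightarrow>
     (\<exists>(N::nat) (a :: nat \<Rightarrow> complex). P = (\<lambda>s. \<Sum>n=1..N. a n / (of_nat n :: complex) powr s))"

(* The library's "sums" starts at index 0, so the term of index n >= 1 sits at position n - 1;
   the value a 0 is irrelevant. *)
definition dirichlet_series_represents_on ::
    "(nat \<Rightarrow> complex) \<Rightarrow> complex set \<Rightarrow> (complex \<Rightarrow> complex) \<Rightarrow> bool" where
  "dirichlet_series_represents_on a S f \<longleftrightarrow>
     (\<forall>s\<in>S. (\<lambda>n. a (Suc n) / (of_nat (Suc n) :: complex) powr s) sums f s)"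

end

theory Submission
  imports Defs "HOL-Probability.Sinc_Integral"
begin

text \<open>
Both directions come from averaging along vertical lines against the kernel
\<open>K(t) = (cos (a t) - cos (b t)) / ((b - a) \<pi> t\<^sup>2)\<close>, whose Fourier transform is the trapezoid
that is \<open>1\<close> on \<open>[-a, a]\<close>, \<open>0\<close> outside \<open>[-b, b]\<close> and linear in between. The function
\<open>n\<^sup>-\<^sup>s\<close> oscillates on a vertical line with the single frequency \<open>ln n\<close>, so averaging
multiplies the \<open>n\<close>-th coefficient of a Dirichlet series by the trapezoid at \<open>ln n\<close>. In particular
it turns a series into a polynomial.

From polynomials to series: a trapezoid falling from \<open>1\<close> to \<open>0\<close> between \<open>ln N\<close> and \<open>ln (N + 1)\<close>
cuts a Dirichlet polynomial off exactly after the term \<open>N\<close>, and the kernel has \<open>L\<^sup>1\<close> norm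
\<open>O(log (N + 1))\<close>. Hence a partial sum is at most \<open>O(log (N + 1))\<close> times the supremum of the polynomial on the
half-plane (Bohr's inequality, \<open>norm_partial_sum_le\<close>). Applied to differences of the approximating
polynomials, this makes the coefficients converge. Moving to the right by \<open>\<delta> > 0\<close> multiplies the terms
by \<open>n\<^sup>-\<^sup>\<delta>\<close>, and summation by parts then absorbs the logarithm: the partial sums of the limit
series stay close to those of a polynomial, uniformly in their length
(\<open>norm_dirichlet_sum_shift_le\<close>). This gives convergence to \<open>f\<close>. Uniform continuity
passes to the limit because a Dirichlet polynomial is Lipschitz on the half-plane.

From series to polynomials: the choice \<open>a = 0\<close>, \<open>b = R\<close> is the Fejer kernel, a nonnegative
approximate identity as \<open>R \<rightarrow> \<infinity>\<close>. A uniformly continuous \<open>f\<close> that is represented by a series is bounded,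
so its Fejer averages converge to it uniformly. Termwise, these averages are Dirichlet polynomials. To
justify the termwise averaging where the series need not converge absolutely, summation by parts bounds
all partial sums at \<open>s + i t\<close> by \<open>C (1 + |t|)\<^sup>\<theta>\<close> with a common \<open>\<theta> < 1\<close>
(\<open>partial_sums_vertical_growth\<close>). As the kernel decays like \<open>t\<^sup>-\<^sup>2\<close>, the averages of the partial
sums converge to the average of \<open>f\<close> by dominated convergence.
\<close>

section \<open>Finite Dirichlet sums\<close>

definition dirichlet_sum :: "(nat \<Rightarrow> complex) \<Rightarrow> nat \<Rightarrow> complex \<Rightarrow> complex" where
  "dirichlet_sum a N s = (\<Sum>n=1..N. a n / of_nat n powr s)"

lemma dirichlet_polynomial_iff:
  "dirichlet_polynomial P \<longleftrightarrow> (\<exists>N a. P = dirichlet_sum a N)"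
  by (simp add: dirichlet_polynomial_def dirichlet_sum_def[abs_def])

lemma dirichlet_series_represents_on_iff:
  "dirichlet_series_represents_on a S f \<longleftrightarrow> (\<forall>s\<in>S. (\<lambda>N. dirichlet_sum a N s) \<longlonglongrightarrow> f s)"
  by (simp add: dirichlet_series_represents_on_def sums_def dirichlet_sum_def sum.atLeast1_atMost_eq
        del: of_nat_Suc)

lemma dirichlet_sum_diff:
  "dirichlet_sum (\<lambda>n. a n - b n) N s = dirichlet_sum a N s - dirichlet_sum b N s"
  by (simp add: dirichlet_sum_def diff_divide_distrib sum_subtractf)

lemma dirichlet_sum_Suc:
  "dirichlet_sum a (Suc N) s = dirichlet_sum a N s + a (Suc N) / of_nat (Suc N) powr s"
  by (simp add: dirichlet_sum_def)

lemma mem_right_half_plane [simp]: "s \<in> right_half_plane \<longleftrightarrow> Re s > 0"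
  by (simp add: right_half_plane_def)

lemma norm_nat_powr: "n > 0 \<Longrightarrow> norm (of_nat n powr w :: complex) = real n powr Re w"
  using norm_powr_real_powr[of "of_nat n" w] by simp

lemma dirichlet_sum_shift:
  "dirichlet_sum c N (s + w) = (\<Sum>n=1..N. c n / of_nat n powr s * of_nat n powr (-w))"
  by (simp add: dirichlet_sum_def powr_add powr_minus divide_inverse mult_ac)

text \<open>
Stated over a commutative ring: it is used for complex sums, and for real ones to evaluate the bound
that \<open>norm_sum_by_parts_le\<close> produces.
\<close>
lemma sum_by_parts:
  fixes c g :: "nat \<Rightarrow> 'a :: comm_ring"
  shows "(\<Sum>n=1..N. c n * g n) =
         (\<Sum>k=1..N. c k) * g N + (\<Sum>n=1..<N. (\<Sum>k=1..n. c k) * (g n - g (Suc n)))"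
proof (induction N)
  case (Suc N)
  show ?case
  proof (cases "N = 0")
    case False
    hence "{1..<Suc N} = insert N {1..<N}" by auto
    thus ?thesis using Suc.IH by (simp add: algebra_simps)
  qed auto
qed auto

lemma norm_sum_by_parts_le:
  fixes c g :: "nat \<Rightarrow> complex"
  assumes "\<And>n. norm (\<Sum>k=1..n. c k) \<le> L n"
  shows "norm (\<Sum>n=1..N. c n * g n) \<le> L N * norm (g N) + (\<Sum>n=1..<N. L n * norm (g n - g (Suc n)))"
proof -
  have "norm (\<Sum>n=1..N. c n * g n) \<le> norm ((\<Sum>k=1..N. c k) * g N) +
          norm (\<Sum>n=1..<N. (\<Sum>k=1..n. c k) * (g n - g (Suc n)))"
    unfolding sum_by_parts[of c g] by (rule norm_triangle_ineq)
  also have "\<dots> \<le> L N * norm (g N) + (\<Sum>n=1..<N. L n * norm (g n - g (Suc n)))"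
    using assms by (intro add_mono sum_norm_le) (auto simp: norm_mult intro!: mult_right_mono)
  finally show ?thesis .
qed

section \<open>The trapezoid kernel and its Fourier transform\<close>

text \<open>
For \<open>x > 0\<close>, integration by parts reduces the integral over \<open>[0, T]\<close> to the sine integral: it equals
\<open>x Si(x T) - (1 - cos (x T)) / T\<close>, and \<open>Si\<close> tends to \<open>\<pi> / 2\<close>. The integrand is nonnegative, so the
limit \<open>T \<rightarrow> \<infinity>\<close> gives the integral over the half-line.
\<close>
lemma has_integral_one_minus_cos_over_square:
  fixes x :: real
  shows "((\<lambda>t. (1 - cos (x * t)) / t\<^sup>2) has_integral pi * \<bar>x\<bar> / 2) {0..}"
proof -
  have pos: "((\<lambda>t. (1 - cos (x * t)) / t\<^sup>2) has_integral pi * x / 2) {0..}" if "x > 0" for x :: real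
  proof -
    define G where "G = (\<lambda>t. x * Si (x * t) - (1 - cos (x * t)) / t)"
    have Si0: "Si 0 = 0" using Si_neg[of 0] by simp
    hence G0: "G 0 = 0" by (simp add: G_def)
    have deriv: "(G has_real_derivative (1 - cos (x * t)) / t\<^sup>2) (at t)" if "t > 0" for t
    proof -
      have "((\<lambda>t. x * Si (x * t)) has_real_derivative x * (sinc (x * t) * x)) (at t)"
        by (intro DERIV_cmult DERIV_chain2[OF DERIV_Si]) (auto intro!: derivative_eq_intros)
      hence 1: "((\<lambda>t. x * Si (x * t)) has_real_derivative x * sin (x * t) / t) (at t)"
        using \<open>x > 0\<close> \<open>t > 0\<close> by simp
      have 2: "((\<lambda>t. (1 - cos (x * t)) / t) has_real_derivative
               x * sin (x * t) / t - (1 - cos (x * t)) / t\<^sup>2) (at t)"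
        using \<open>t > 0\<close> by (auto intro!: derivative_eq_intros simp: field_simps power2_eq_square)
      show ?thesis unfolding G_def using DERIV_diff[OF 1 2] by simp
    qed
    (* Division by zero yields 0 at t = 0, which is the right value for continuity of G. *)
    have cont0: "isCont G 0"
    proof -
      have "((\<lambda>t. (1 - cos (x * t))) has_real_derivative 0) (at 0)"
        by (auto intro!: derivative_eq_intros)
      hence "((\<lambda>t. (1 - cos (x * t)) / t) \<longlongrightarrow> 0) (at 0)"
        by (simp add: has_field_derivative_def field_has_derivative_at)
      moreover have "isCont (\<lambda>t. x * Si (x * t)) 0"
        by (intro continuous_intros isCont_o2[OF _ isCont_Si])
      ultimately have "(G \<longlongrightarrow> x * Si (x * 0) - 0) (at 0)"
        unfolding G_def by (intro tendsto_diff) (simp_all add: isCont_def)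
      thus ?thesis using G0 Si0 by (simp add: isCont_def)
    qed
    have hi: "((\<lambda>t. (1 - cos (x * t)) / t\<^sup>2) has_integral G T) {0..T}" if "T \<ge> 0" for T
    proof -
      have "((\<lambda>t. (1 - cos (x * t)) / t\<^sup>2) has_integral (G T - G 0)) {0..T}"
      proof (rule fundamental_theorem_of_calculus_interior[OF that])
        have "isCont G t" if "t \<ge> 0" for t
          using that cont0 deriv[of t] by (cases "t = 0") (auto intro: DERIV_isCont)
        thus "continuous_on {0..T} G"
          by (auto intro!: continuous_at_imp_continuous_on)
        show "\<And>t. t \<in> {0<..<T} \<Longrightarrow> (G has_vector_derivative (1 - cos (x * t)) / t\<^sup>2) (at t)"
          using deriv by (simp add: has_real_derivative_iff_has_vector_derivative)
      qed
      thus ?thesis by (simp add: G0)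
    qed
    have "((\<lambda>T. x * Si (x * T)) \<longlongrightarrow> x * (pi / 2)) at_top"
      by (intro tendsto_mult tendsto_const filterlim_compose[OF Si_at_top]
            filterlim_tendsto_pos_mult_at_top[OF tendsto_const \<open>x > 0\<close>] filterlim_ident)
    moreover have "((\<lambda>T::real. (1 - cos (x * T)) / T) \<longlongrightarrow> 0) at_top"
    proof (rule tendsto_0_le[of "\<lambda>T::real. 1 / T" _ _ 2])
      show "((\<lambda>T::real. 1 / T) \<longlongrightarrow> 0) at_top"
        by (intro tendsto_divide_0[OF tendsto_const] filterlim_at_top_imp_at_infinity filterlim_ident)
      have "\<bar>1 - cos y\<bar> \<le> 2" for y :: real
        using cos_ge_minus_one[of y] cos_le_one[of y] by linarith
      thus "\<forall>\<^sub>F T in at_top. norm ((1 - cos (x * T)) / T) \<le> norm (1 / T) * 2"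
        by (intro always_eventually) (auto simp: divide_right_mono abs_divide)
    qed
    ultimately have "(G \<longlongrightarrow> x * (pi / 2) - 0) at_top"
      unfolding G_def by (rule tendsto_diff)
    hence lim: "(G \<longlongrightarrow> pi * x / 2) at_top" by (simp add: mult_ac)
    show ?thesis
    proof (rule has_integral_to_inf)
      show "(\<lambda>t. (1 - cos (x * t)) / t\<^sup>2) integrable_on {0..T}" for T
        using hi[of T] by (cases "T \<ge> 0") (auto simp: integrable_on_def)
      have "\<forall>\<^sub>F T in at_top. G T = integral {0..T} (\<lambda>t. (1 - cos (x * t)) / t\<^sup>2)"
        using eventually_ge_at_top[of 0] by eventually_elim (rule integral_unique[symmetric, OF hi])
      thus "((\<lambda>T. integral {0..T} (\<lambda>t. (1 - cos (x * t)) / t\<^sup>2)) \<longlongrightarrow> pi * x / 2) at_top"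
        using lim by (rule Lim_transform_eventually[rotated])
      show "0 \<le> (1 - cos (x * t)) / t\<^sup>2" for t by simp
    qed
  qed
  show ?thesis
  proof (cases x "0 :: real" rule: linorder_cases)
    case less
    thus ?thesis using pos[of "-x"] by simp
  next
    case equal
    thus ?thesis by simp
  next
    case greater
    thus ?thesis using pos[of x] by simp
  qed
qed

text \<open>
The kernel is even, so integrals over the half-line \<open>[0, \<infinity>)\<close> with \<open>t\<close> and \<open>-t\<close> paired replace
integrals over the whole line throughout.
\<close>
definition trapezoid_kernel :: "real \<Rightarrow> real \<Rightarrow> real \<Rightarrow> real" where
  "trapezoid_kernel a b t = (cos (a * t) - cos (b * t)) / ((b - a) * pi * t\<^sup>2)"

definition trapezoid :: "real \<Rightarrow> real \<Rightarrow> real \<Rightarrow> real" where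
  "trapezoid a b x = (\<bar>x + b\<bar> + \<bar>x - b\<bar> - \<bar>x + a\<bar> - \<bar>x - a\<bar>) / (2 * (b - a))"

text \<open>
The product formula for cosines writes \<open>2 K(t) cos (x t)\<close> as a combination of the functions
\<open>(1 - cos (y t)) / t\<^sup>2\<close> for \<open>y = x \<plusminus> a\<close> and \<open>y = x \<plusminus> b\<close>. Each of them integrates to a multiple
of \<open>|y|\<close>, and these four absolute values make up the trapezoid.
\<close>
lemma has_integral_trapezoid_kernel_cos:
  assumes "a < b"
  shows "((\<lambda>t. 2 * trapezoid_kernel a b t * cos (x * t)) has_integral trapezoid a b x) {0..}"
proof -
  define h where "h = (\<lambda>y t::real. (1 - cos (y * t)) / t\<^sup>2)"
  have h: "(h y has_integral pi * \<bar>y\<bar> / 2) {0..}" for y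
    unfolding h_def by (rule has_integral_one_minus_cos_over_square)
  let ?c = "1 / ((b - a) * pi)"
  have "((\<lambda>t. ?c * (h (x + b) t + h (x - b) t - h (x + a) t - h (x - a) t)) has_integral
        ?c * (pi * \<bar>x + b\<bar> / 2 + pi * \<bar>x - b\<bar> / 2 - pi * \<bar>x + a\<bar> / 2 - pi * \<bar>x - a\<bar> / 2)) {0..}"
    by (intro has_integral_mult_right has_integral_diff has_integral_add h)
  also have "(\<lambda>t. ?c * (h (x + b) t + h (x - b) t - h (x + a) t - h (x - a) t)) =
             (\<lambda>t. 2 * trapezoid_kernel a b t * cos (x * t))"
  proof
    fix t
    have "h (x + b) t + h (x - b) t - h (x + a) t - h (x - a) t =
          (cos (x*t + a*t) + cos (x*t - a*t) - cos (x*t + b*t) - cos (x*t - b*t)) / t\<^sup>2"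
      by (simp add: h_def add_divide_distrib diff_divide_distrib algebra_simps)
    also have "\<dots> = 2 * cos (x*t) * (cos (a*t) - cos (b*t)) / t\<^sup>2"
      by (simp add: cos_add cos_diff algebra_simps)
    finally show "?c * (h (x + b) t + h (x - b) t - h (x + a) t - h (x - a) t) =
                  2 * trapezoid_kernel a b t * cos (x * t)"
      by (simp add: trapezoid_kernel_def)
  qed
  also have "?c * (pi * \<bar>x + b\<bar> / 2 + pi * \<bar>x - b\<bar> / 2 - pi * \<bar>x + a\<bar> / 2 - pi * \<bar>x - a\<bar> / 2) =
             trapezoid a b x"
    using assms by (simp add: trapezoid_def field_simps)
  finally show ?thesis .
qed

lemma trapezoid_eq_1: "\<bar>x\<bar> \<le> a \<Longrightarrow> a < b \<Longrightarrow> trapezoid a b x = 1"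
proof -
  assume *: "\<bar>x\<bar> \<le> a" "a < b"
  hence "\<bar>x + b\<bar> = x + b" "\<bar>x - b\<bar> = b - x" "\<bar>x + a\<bar> = x + a" "\<bar>x - a\<bar> = a - x" by linarith+
  hence "trapezoid a b x = 2 * (b - a) / (2 * (b - a))" by (simp add: trapezoid_def)
  thus ?thesis using * by simp
qed

lemma trapezoid_eq_0: "0 \<le> a \<Longrightarrow> a < b \<Longrightarrow> b \<le> \<bar>x\<bar> \<Longrightarrow> trapezoid a b x = 0"
proof -
  assume "0 \<le> a" "a < b" "b \<le> \<bar>x\<bar>"
  hence "\<bar>x + b\<bar> + \<bar>x - b\<bar> = 2 * \<bar>x\<bar>" "\<bar>x + a\<bar> + \<bar>x - a\<bar> = 2 * \<bar>x\<bar>" by linarith+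
  hence "\<bar>x + b\<bar> + \<bar>x - b\<bar> - \<bar>x + a\<bar> - \<bar>x - a\<bar> = 0" by linarith
  thus ?thesis by (simp add: trapezoid_def)
qed

lemma abs_cos_diff_le:
  fixes a b t :: real
  assumes "0 \<le> a" "a \<le> b" "0 \<le> t"
  shows "\<bar>cos (a * t) - cos (b * t)\<bar> \<le> (b - a) * t"
    and "\<bar>cos (a * t) - cos (b * t)\<bar> \<le> (b - a) * (a + b) / 2 * t\<^sup>2"
proof -
  have "cos (a * t) - cos (b * t) = 2 * sin ((a * t + b * t) / 2) * sin ((b * t - a * t) / 2)"
    by (rule cos_diff_cos)
  hence eq: "\<bar>cos (a * t) - cos (b * t)\<bar> =
        2 * (\<bar>sin ((a * t + b * t) / 2)\<bar> * \<bar>sin ((b * t - a * t) / 2)\<bar>)"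
    by (simp add: abs_mult)
  have nn: "0 \<le> (b - a) * t" using assms by simp
  have 1: "\<bar>sin ((a * t + b * t) / 2)\<bar> \<le> (a + b) * t / 2"
    using abs_sin_x_le_abs_x[of "(a * t + b * t) / 2"] assms by (simp add: algebra_simps)
  have "\<bar>sin ((b * t - a * t) / 2)\<bar> \<le> \<bar>(b * t - a * t) / 2\<bar>"
    by (rule abs_sin_x_le_abs_x)
  also have "\<dots> = (b - a) * t / 2" using nn by (simp add: algebra_simps)
  finally have 2: "\<bar>sin ((b * t - a * t) / 2)\<bar> \<le> (b - a) * t / 2" .
  have "\<bar>sin ((a * t + b * t) / 2)\<bar> * \<bar>sin ((b * t - a * t) / 2)\<bar> \<le> 1 * ((b - a) * t / 2)"
    by (intro mult_mono 2) auto
  thus "\<bar>cos (a * t) - cos (b * t)\<bar> \<le> (b - a) * t" unfolding eq by simp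
  have "\<bar>sin ((a * t + b * t) / 2)\<bar> * \<bar>sin ((b * t - a * t) / 2)\<bar> \<le> (a + b) * t / 2 * ((b - a) * t / 2)"
    using assms by (intro mult_mono 1 2) auto
  thus "\<bar>cos (a * t) - cos (b * t)\<bar> \<le> (b - a) * (a + b) / 2 * t\<^sup>2"
    unfolding eq by (simp add: power2_eq_square field_simps)
qed

text \<open>
The three bounds are used for small, medium and large \<open>t\<close>. The middle one, free of \<open>a\<close> and \<open>b\<close>,
is what keeps the \<open>L\<^sup>1\<close> norm logarithmic although the trapezoid may be very steep.
\<close>
lemma abs_trapezoid_kernel_le:
  assumes "0 \<le> a" "a < b" "0 \<le> t"
  shows "\<bar>trapezoid_kernel a b t\<bar> \<le> (a + b) / (2 * pi)"
    and "\<bar>trapezoid_kernel a b t\<bar> \<le> 1 / (pi * t)"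
    and "\<bar>trapezoid_kernel a b t\<bar> \<le> 2 / ((b - a) * pi * t\<^sup>2)"
proof -
  have eq: "\<bar>trapezoid_kernel a b t\<bar> = \<bar>cos (a * t) - cos (b * t)\<bar> / ((b - a) * pi * t\<^sup>2)"
    using assms by (simp add: trapezoid_kernel_def abs_divide abs_mult)
  have "\<bar>cos (a * t) - cos (b * t)\<bar> \<le> 2"
    using cos_ge_minus_one[of "a*t"] cos_le_one[of "a*t"] cos_ge_minus_one[of "b*t"] cos_le_one[of "b*t"]
    by linarith
  thus "\<bar>trapezoid_kernel a b t\<bar> \<le> 2 / ((b - a) * pi * t\<^sup>2)"
    unfolding eq using assms by (intro divide_right_mono) auto
  show "\<bar>trapezoid_kernel a b t\<bar> \<le> 1 / (pi * t)"
  proof (cases "t = 0")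
    case False
    have "\<bar>cos (a * t) - cos (b * t)\<bar> / ((b - a) * pi * t\<^sup>2) \<le> (b - a) * t / ((b - a) * pi * t\<^sup>2)"
      using assms by (intro divide_right_mono abs_cos_diff_le) auto
    also have "\<dots> = 1 / (pi * t)" using assms False by (simp add: field_simps power2_eq_square)
    finally show ?thesis unfolding eq .
  qed (simp add: trapezoid_kernel_def)
  show "\<bar>trapezoid_kernel a b t\<bar> \<le> (a + b) / (2 * pi)"
  proof (cases "t = 0")
    case False
    have "\<bar>cos (a * t) - cos (b * t)\<bar> / ((b - a) * pi * t\<^sup>2) \<le>
          ((b - a) * (a + b) / 2 * t\<^sup>2) / ((b - a) * pi * t\<^sup>2)"
      using assms by (intro divide_right_mono abs_cos_diff_le) auto
    also have "\<dots> = (a + b) / (2 * pi)" using assms False by simp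
    finally show ?thesis unfolding eq .
  qed (use assms in \<open>simp add: trapezoid_kernel_def\<close>)
qed

text \<open>
The factor in front of \<open>B\<close> bounds the \<open>L\<^sup>1\<close> norm of the kernel on the half-line: the three
pointwise bounds are integrated over \<open>[0, 1]\<close>, \<open>[1, R]\<close> and \<open>[R, \<infinity>)\<close>. The parameter \<open>R\<close> is
best chosen near \<open>1 / (b - a)\<close>.
\<close>
lemma norm_trapezoid_average_le:
  fixes G :: "real \<Rightarrow> complex"
  assumes ab: "0 \<le> a" "a < b" and R: "1 \<le> R" and bound: "\<And>t. norm (G t) \<le> B"
    and int: "((\<lambda>t. of_real (trapezoid_kernel a b t) * G t) has_integral I) {0..}"
  shows "norm I \<le> ((a + b) / 2 + ln R + 2 / ((b - a) * R)) / pi * B"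
proof -
  have B: "0 \<le> B" using bound[of 0] norm_ge_zero order_trans by blast
  define g where "g = (\<lambda>t. if t \<le> 1 then (a + b) / (2 * pi) else
                        if t \<le> R then 1 / pi * (1 / t) else 2 / ((b - a) * pi) * (1 / t\<^sup>2))"
  have 1: "(g has_integral (a + b) / (2 * pi)) {0..1}"
  proof (rule has_integral_eq)
    show "((\<lambda>t::real. (a + b) / (2 * pi)) has_integral (a + b) / (2 * pi)) {0..1}"
      using has_integral_const_real[of "(a + b) / (2 * pi)" 0 1] by simp
  qed (simp add: g_def)
  have "((\<lambda>t. 1 / pi * (1 / t)) has_integral 1 / pi * (ln R - ln 1)) {1..R}"
    using R by (intro has_integral_mult_right fundamental_theorem_of_calculus)
       (auto intro!: derivative_eq_intros simp flip: has_real_derivative_iff_has_vector_derivative)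
  hence 2: "(g has_integral 1 / pi * (ln R - ln 1)) {1..R}"
    by (rule has_integral_spike_finite[of "{1}", rotated 2]) (auto simp: g_def)
  have "((\<lambda>t. 2 / ((b - a) * pi) * (1 / t\<^sup>2)) has_integral
          2 / ((b - a) * pi) * (1 / (real (2 - 1) * R ^ (2 - 1)))) {R..}"
    using R by (intro has_integral_mult_right has_integral_inverse_power_to_inf) auto
  hence 3: "(g has_integral 2 / ((b - a) * pi) * (1 / (real (2 - 1) * R ^ (2 - 1)))) {R..}"
    by (rule has_integral_spike_finite[of "{R}", rotated 2]) (use R in \<open>auto simp: g_def\<close>)
  have "(g has_integral ((a + b) / (2 * pi) + 1 / pi * (ln R - ln 1)) +
            2 / ((b - a) * pi) * (1 / (real (2 - 1) * R ^ (2 - 1)))) (({0..1} \<union> {1..R}) \<union> {R..})"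
  proof (intro has_integral_Un 1 2 3)
    have "{0..1} \<inter> {1..R} \<subseteq> {1}" "({0..1} \<union> {1..R}) \<inter> {R..} \<subseteq> {R}" using R by auto
    thus "negligible ({0..1} \<inter> {1..R})" "negligible (({0..1} \<union> {1..R}) \<inter> {R..})"
      using negligible_subset negligible_sing by blast+
  qed
  also have "({0..1} \<union> {1..R}) \<union> {R..} = {0..}" using R by auto
  also have "((a + b) / (2 * pi) + 1 / pi * (ln R - ln 1)) +
            2 / ((b - a) * pi) * (1 / (real (2 - 1) * R ^ (2 - 1))) =
            ((a + b) / 2 + ln R + 2 / ((b - a) * R)) / pi"
    by (simp add: add_divide_distrib mult_ac)
  finally have g: "((\<lambda>t. g t * B) has_integral ((a + b) / 2 + ln R + 2 / ((b - a) * R)) / pi * B) {0..}"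
    by (rule has_integral_mult_left)
  have "norm (integral {0..} (\<lambda>t. of_real (trapezoid_kernel a b t) * G t)) \<le> integral {0..} (\<lambda>t. g t * B)"
  proof (rule Henstock_Kurzweil_Integration.integral_norm_bound_integral)
    fix t :: real assume "t \<in> {0..}"
    hence "\<bar>trapezoid_kernel a b t\<bar> \<le> g t"
      using abs_trapezoid_kernel_le[of a b t] ab by (simp add: g_def)
    thus "norm (of_real (trapezoid_kernel a b t) * G t) \<le> g t * B"
      unfolding norm_mult norm_of_real using bound[of t] by (intro mult_mono') auto
  qed (use int g in \<open>auto simp: integrable_on_def\<close>)
  thus ?thesis unfolding integral_unique[OF int] integral_unique[OF g] .
qed

section \<open>Vertical averages of Dirichlet sums\<close>

definition vertical_pair :: "(complex \<Rightarrow> complex) \<Rightarrow> complex \<Rightarrow> real \<Rightarrow> complex" where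
  "vertical_pair F s t = F (s + \<i> * t) + F (s - \<i> * t)"

text \<open>
On the vertical line through \<open>s\<close> the function \<open>n\<^sup>-\<^sup>s\<close> is a pure oscillation of frequency \<open>ln n\<close>.
\<close>
lemma vertical_pair_powr:
  assumes "n > 0"
  shows "vertical_pair (\<lambda>s. 1 / of_nat n powr s) s t = of_real (2 * cos (ln n * t)) * (1 / of_nat n powr s)"
proof -
  have "vertical_pair (\<lambda>s. 1 / of_nat n powr s) s t = 
     exp (-s * of_real (ln n)) * (exp (\<i> * of_real (ln n * t)) + exp (-\<i> * of_real (ln n * t)))"
    using assms
    by (simp add: vertical_pair_def powr_def exp_minus[symmetric] divide_inverse exp_add[symmetric]
          algebra_simps
          flip: Ln_of_nat)
  also have "exp (\<i> * of_real (ln n * t)) + exp (-\<i> * of_real (ln n * t)) = 2 * of_real (cos (ln n * t))"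
    by (simp flip: cos_of_real add: cos_exp_eq)
  finally show ?thesis
    using assms by (simp add: powr_def exp_minus divide_inverse mult_ac)
qed

lemma has_integral_trapezoid_kernel_dirichlet_sum:
  assumes "a < b"
  shows "((\<lambda>t. of_real (trapezoid_kernel a b t) * vertical_pair (dirichlet_sum c N) s t) has_integral
           dirichlet_sum (\<lambda>n. of_real (trapezoid a b (ln n)) * c n) N s) {0..}"
proof -
  have "((\<lambda>t. (\<Sum>n=1..N. c n / of_nat n powr s * of_real (2 * trapezoid_kernel a b t * cos (ln n * t))))
         has_integral (\<Sum>n=1..N. c n / of_nat n powr s * of_real (trapezoid a b (ln n)))) {0..}"
    by (intro has_integral_sum has_integral_mult_right has_integral_of_real
          has_integral_trapezoid_kernel_cos assms) auto
  moreover have "of_real (trapezoid_kernel a b t) * vertical_pair (dirichlet_sum c N) s t =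
     (\<Sum>n=1..N. c n / of_nat n powr s * of_real (2 * trapezoid_kernel a b t * cos (ln n * t)))" for t
  proof -
    have "vertical_pair (dirichlet_sum c N) s t = 
       (\<Sum>n=1..N. c n * vertical_pair (\<lambda>s. 1 / of_nat n powr s) s t)"
      by (simp add: vertical_pair_def dirichlet_sum_def sum.distrib distrib_left)
    also have "\<dots> = (\<Sum>n=1..N. c n * (of_real (2 * cos (ln n * t)) * (1 / of_nat n powr s)))"
      by (intro sum.cong refl) (subst vertical_pair_powr, auto)
    finally show ?thesis by (simp add: sum_distrib_left mult_ac)
  qed
  ultimately show ?thesis by (simp add: dirichlet_sum_def mult_ac)
qed

section \<open>Bohr's inequality for partial sums\<close>

text \<open>
The trapezoid with \<open>a = ln N\<close> and \<open>b = ln (N + 1)\<close> takes only the values \<open>1\<close> and \<open>0\<close> at the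
frequencies \<open>ln n\<close>, with the change right after \<open>n = N\<close>. So the partial sum is an average of the
whole sum, and it suffices to bound the kernel's \<open>L\<^sup>1\<close> norm. The harmonic number serves as the
logarithm here because its increments \<open>1 / n\<close> are convenient for summation by parts.
\<close>
lemma norm_partial_sum_le:
  assumes N: "N > 0" "N \<le> M" and s: "Re s > 0"
    and bound: "\<And>s. Re s > 0 \<Longrightarrow> norm (dirichlet_sum c M s) \<le> B"
  shows "norm (dirichlet_sum c N s) \<le> 4 * harm N * B"
proof -
  define a b where "a = ln (real N)" and "b = ln (real N + 1)"
  have ab: "0 \<le> a" "a < b" using N by (auto simp: a_def b_def)
  have B: "0 \<le> B" by (rule order.trans[OF norm_ge_zero bound[of 1]]) simp
  have cut: "dirichlet_sum (\<lambda>n. of_real (trapezoid a b (ln n)) * c n) M s = dirichlet_sum c N s"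
  proof -
    have "trapezoid a b (ln n) = (if n \<le> N then 1 else 0)" if "n \<ge> 1" for n :: nat
    proof (cases "n \<le> N")
      case True
      thus ?thesis using that ab by (auto intro!: trapezoid_eq_1 simp: a_def)
    next
      case False
      hence "real N + 1 \<le> real n" by linarith
      thus ?thesis using that ab False by (auto intro!: trapezoid_eq_0 simp: b_def)
    qed
    hence "dirichlet_sum (\<lambda>n. of_real (trapezoid a b (ln n)) * c n) M s =
          (\<Sum>n=1..M. if n \<le> N then c n / of_nat n powr s else 0)"
      unfolding dirichlet_sum_def by (intro sum.cong) auto
    also have "\<dots> = dirichlet_sum c N s"
      unfolding dirichlet_sum_def using N by (intro sum.mono_neutral_cong_right) auto
    finally show ?thesis .
  qed
  have "norm (vertical_pair (dirichlet_sum c M) s t) \<le> 2 * B" for t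
    unfolding vertical_pair_def using bound[of "s + \<i> * t"] bound[of "s - \<i> * t"] s
    by (intro order.trans[OF norm_triangle_ineq]) auto
  from norm_trapezoid_average_le[OF ab, of "real N + 1" "vertical_pair (dirichlet_sum c M) s", OF _ this
         has_integral_trapezoid_kernel_dirichlet_sum[OF ab(2)]]
  have "norm (dirichlet_sum c N s) \<le>
          ((a + b) / 2 + ln (real N + 1) + 2 / ((b - a) * (real N + 1))) / pi * (2 * B)"
    unfolding cut by simp
  also have "\<dots> \<le> (4 * harm N / 2) * (2 * B)"
  proof (intro mult_right_mono frac_le)
    have 1: "b \<le> harm N" unfolding b_def by (rule ln_le_harm)
    have "harm 1 \<le> (harm N :: real)" using N by (intro harm_mono) auto
    hence 2: "1 \<le> (harm N :: real)" by (simp add: harm_def)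
    (* The slope of the trapezoid is at most N + 1, which matches the choice R = N + 1 above. *)
    have "a - b \<le> real N / (real N + 1) - 1"
      using ln_le_minus_one[of "real N / (real N + 1)"] N by (simp add: a_def b_def ln_div)
    also have "\<dots> = - (1 / (real N + 1))" by (simp add: field_simps)
    finally have "1 / (real N + 1) \<le> b - a" by simp
    hence "1 \<le> (b - a) * (real N + 1)" by (simp add: pos_divide_le_eq)
    hence "2 / ((b - a) * (real N + 1)) \<le> 2 / 1" by (intro divide_left_mono) auto
    also have "\<dots> \<le> 2 * harm N" using 2 by simp
    finally have 3: "2 / ((b - a) * (real N + 1)) \<le> 2 * harm N" .
    have "(a + b) / 2 + b + 2 / ((b - a) * (real N + 1)) \<le> harm N + harm N + 2 * harm N"
      using 1 ab by (intro add_mono 3) auto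
    thus "(a + b) / 2 + ln (real N + 1) + 2 / ((b - a) * (real N + 1)) \<le> 4 * harm N"
      by (simp add: b_def)
  qed (use B pi_ge_two in \<open>auto simp: harm_nonneg\<close>)
  finally show ?thesis by simp
qed

text \<open>
Summation by parts twice: once to pass to the assumed bounds \<open>harm N * e\<close> on the partial sums, and
once backwards to evaluate the result, where the increments of \<open>harm\<close> turn \<open>n\<^sup>-\<^sup>d\<close> into the summable
\<open>n\<^sup>-\<^sup>1\<^sup>-\<^sup>d\<close>. The point is that the bound is independent of \<open>N\<close>.
\<close>
lemma norm_dirichlet_sum_shift_le:
  assumes d: "0 < d" and e: "0 \<le> e" and bound: "\<And>N. norm (dirichlet_sum c N s) \<le> harm N * e"
  shows "norm (dirichlet_sum c N (s + of_real d)) \<le> e * (\<Sum>n. real n powr (-1 - d))"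
proof -
  define g where "g = (\<lambda>n. real n powr (-d))"
  have g_eq: "of_nat n powr (- of_real d :: complex) = of_real (g n)" for n
    unfolding g_def using powr_of_real[of "real n" "-d"] by simp
  have g_dec: "g (Suc n) \<le> g n" if "n \<ge> 1" for n
    unfolding g_def using d that by (intro powr_mono2') auto
  have "norm (dirichlet_sum c N (s + of_real d)) \<le>
         harm N * e * norm (complex_of_real (g N)) + 
         (\<Sum>n=1..<N. harm n * e * norm (of_real (g n) - complex_of_real (g (Suc n))))"
    unfolding dirichlet_sum_shift g_eq
    by (rule norm_sum_by_parts_le) (use bound in \<open>simp add: dirichlet_sum_def\<close>)
  also have "\<dots> = e * (harm N * g N + (\<Sum>n=1..<N. harm n * (g n - g (Suc n))))"
  proof -
    have "(\<Sum>n=1..<N. harm n * e * norm (of_real (g n) - complex_of_real (g (Suc n)))) =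
          (\<Sum>n=1..<N. e * (harm n * (g n - g (Suc n))))"
      using g_dec by (intro sum.cong) (simp_all flip: of_real_diff)
    thus ?thesis by (simp add: sum_distrib_left algebra_simps g_def)
  qed
  also have "harm N * g N + (\<Sum>n=1..<N. harm n * (g n - g (Suc n))) = (\<Sum>n=1..N. inverse (real n) * g n)"
    by (subst sum_by_parts) (simp add: harm_def)
  also have "\<dots> = (\<Sum>n=1..N. real n powr (-1 - d))"
    by (intro sum.cong) (auto simp: g_def powr_diff powr_minus divide_inverse)
  also have "\<dots> \<le> (\<Sum>n. real n powr (-1 - d))"
    using d by (intro sum_le_suminf) (auto simp: summable_real_powr_iff)
  finally show ?thesis using e by (simp add: mult_left_mono)
qed

section \<open>Uniform limits of Dirichlet polynomials\<close>

text \<open>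
The derivative of \<open>n\<^sup>-\<^sup>s\<close> is bounded by \<open>ln n\<close> on the half-plane.
\<close>
lemma dirichlet_sum_lipschitz:
  obtains C where "C \<ge> 0"
    "\<And>s w. Re s > 0 \<Longrightarrow> Re w > 0 \<Longrightarrow> norm (dirichlet_sum c N s - dirichlet_sum c N w) \<le> C * norm (s - w)"
proof
  have term_le: "norm (of_nat n powr (-s) - of_nat n powr (-w) :: complex) \<le> ln n * norm (s - w)"
    if "n \<ge> 1" "Re s > 0" "Re w > 0" for n :: nat and s w :: complex
  proof (rule field_differentiable_bound)
    show "convex right_half_plane" by (simp add: right_half_plane_def convex_halfspace_Re_gt)
    have deriv: "((\<lambda>s. of_nat n powr (-s)) has_field_derivative
                   (Ln (of_nat n) * of_nat n powr (-s)) * (-1)) (at s)"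
      for s :: complex
      by (rule DERIV_chain2[OF has_field_derivative_powr_right])
         (use that in \<open>auto intro!: derivative_eq_intros\<close>)
    show "((\<lambda>s. of_nat n powr (-s)) has_field_derivative - Ln (of_nat n) * of_nat n powr (-s))
            (at s within right_half_plane)" for s :: complex
      using has_field_derivative_at_within[OF deriv] by simp
    fix s :: complex assume "s \<in> right_half_plane"
    have "norm (of_nat n powr (-s) :: complex) = real n powr (- Re s)"
      using norm_powr_real_powr[of "of_nat n" "-s"] by simp
    also have "\<dots> \<le> 1 powr (- Re s)"
      using that \<open>s \<in> right_half_plane\<close> by (intro powr_mono2') auto
    finally have "norm (of_nat n powr (-s) :: complex) \<le> 1" by simp
    moreover have "norm (- Ln (of_nat n) :: complex) = ln n"
      using that by (simp add: Ln_of_nat)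
    ultimately show "norm (- Ln (of_nat n) * of_nat n powr (-s) :: complex) \<le> ln n"
      using that unfolding norm_mult by (simp add: mult_left_le)
  qed (use that in auto)
  let ?C = "\<Sum>n=1..N. norm (c n) * ln n"
  show "?C \<ge> 0" by (intro sum_nonneg) auto
  fix s w :: complex assume sw: "Re s > 0" "Re w > 0"
  have "dirichlet_sum c N s - dirichlet_sum c N w =
          (\<Sum>n=1..N. c n * (of_nat n powr (-s) - of_nat n powr (-w)))"
    by (simp add: dirichlet_sum_def powr_minus divide_inverse sum_subtractf algebra_simps)
  also have "norm \<dots> \<le> (\<Sum>n=1..N. norm (c n) * (ln n * norm (s - w)))"
    using sw by (intro sum_norm_le) (auto simp: norm_mult intro!: mult_left_mono term_le)
  finally show "norm (dirichlet_sum c N s - dirichlet_sum c N w) \<le> ?C * norm (s - w)"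
    unfolding sum_distrib_right by (simp only: mult.assoc)
qed

lemma uniformly_continuous_on_dirichlet_sum:
  "uniformly_continuous_on right_half_plane (dirichlet_sum c N)"
proof -
  obtain C where C: "C \<ge> 0" and lip: 
    "\<And>s w. Re s > 0 \<Longrightarrow> Re w > 0 \<Longrightarrow> norm (dirichlet_sum c N s - dirichlet_sum c N w) \<le> C * norm (s - w)"
    using dirichlet_sum_lipschitz by blast
  have "C-lipschitz_on right_half_plane (dirichlet_sum c N)"
    using C lip by (auto intro!: lipschitz_onI simp: dist_norm)
  thus ?thesis by (rule lipschitz_on_uniformly_continuous)
qed

lemma uniformly_continuous_on_uniform_limit:
  fixes P :: "nat \<Rightarrow> 'a::metric_space \<Rightarrow> 'b::metric_space"
  assumes "\<And>k. uniformly_continuous_on S (P k)" "uniform_limit S P f sequentially"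
  shows "uniformly_continuous_on S f"
  unfolding uniformly_continuous_on_def
proof (intro allI impI)
  fix e :: real assume e: "e > 0"
  have "\<forall>\<^sub>F k in sequentially. \<forall>x\<in>S. dist (P k x) (f x) < e / 3"
    using e by (intro uniform_limitD[OF assms(2)]) simp
  then obtain k where k: "\<And>x. x \<in> S \<Longrightarrow> dist (P k x) (f x) < e / 3"
    unfolding eventually_sequentially by blast
  have "e / 3 > 0" using e by simp
  then obtain d where "d > 0" and d: "\<And>x y. x \<in> S \<Longrightarrow> y \<in> S \<Longrightarrow> dist y x < d \<Longrightarrow> dist (P k y) (P k x) < e / 3"
    using assms(1)[of k] unfolding uniformly_continuous_on_def by blast
  have "dist (f y) (f x) < e" if "x \<in> S" "y \<in> S" "dist y x < d" for x y
    using k[OF that(1)] k[OF that(2)] d[OF that]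
      dist_triangle[of "f y" "f x" "P k y"] dist_triangle[of "P k y" "f x" "P k x"]
    by (simp add: dist_commute)
  thus "\<exists>d>0. \<forall>x\<in>S. \<forall>y\<in>S. dist y x < d \<longrightarrow> dist (f y) (f x) < e"
    using \<open>d > 0\<close> by blast
qed

text \<open>
Bohr's inequality shows that for each \<open>N\<close> the partial sums of length \<open>N\<close> of the approximating
polynomials, taken at \<open>s = 1\<close>, form a Cauchy sequence, so the coefficients have limits \<open>a n\<close>.
Its bound survives in the limit, and after a shift by half the real part of \<open>s\<close> it no longer depends on \<open>N\<close>. Hence the \<open>N\<close>-th partial sum of
the limit series differs little from a fixed polynomial \<open>P\<^sub>K\<close> as soon as \<open>N\<close> exceeds the length
of \<open>P\<^sub>K\<close>, and \<open>P\<^sub>K\<close> is close to \<open>f\<close>.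
\<close>
lemma uniform_limit_dirichlet_sums_represented:
  fixes M :: "nat \<Rightarrow> nat"
  assumes lim: "uniform_limit right_half_plane (\<lambda>k. dirichlet_sum (c k) (M k)) f sequentially"
  shows "\<exists>a. dirichlet_series_represents_on a right_half_plane f"
proof -
  (* Padding by zeros makes partial sums of every length available for all polynomials. *)
  define d where "d = (\<lambda>k n. if n \<le> M k then c k n else 0)"
  have pad: "dirichlet_sum (d k) N s = dirichlet_sum (c k) (M k) s" if "N \<ge> M k" for k N s
    unfolding d_def dirichlet_sum_def using that by (intro sum.mono_neutral_cong_right) auto
  have approx: "\<exists>K. \<forall>k\<ge>K. \<forall>s. Re s > 0 \<longrightarrow> norm (dirichlet_sum (c k) (M k) s - f s) \<le> e" if "e > 0" for e
    using lim that
    unfolding uniform_limit_iff eventually_sequentially dist_norm by (meson less_imp_le mem_right_half_plane)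
  have diff: "norm (dirichlet_sum (d k) N s - dirichlet_sum (d l) N s) \<le> 4 * harm N * (2 * e)"
    if K: "\<forall>k\<ge>K. \<forall>s. Re s > 0 \<longrightarrow> norm (dirichlet_sum (c k) (M k) s - f s) \<le> e"
      and kl: "k \<ge> K" "l \<ge> K" and s: "Re s > 0"
    for K k l N e s
  proof (cases "N = 0")
    case False
    have "norm (dirichlet_sum (\<lambda>n. d k n - d l n) N s) \<le> 4 * harm N * (2 * e)"
    proof (rule norm_partial_sum_le)
      fix s :: complex assume "Re s > 0"
      hence "norm (dirichlet_sum (c k) (M k) s - f s) \<le> e" "norm (dirichlet_sum (c l) (M l) s - f s) \<le> e"
        using K kl by auto
      thus "norm (dirichlet_sum (\<lambda>n. d k n - d l n) (Max {N, M k, M l}) s) \<le> 2 * e"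
        unfolding dirichlet_sum_diff
        using norm_triangle_ineq4[of "dirichlet_sum (c k) (M k) s - f s" "dirichlet_sum (c l) (M l) s - f s"]
        by (subst (1 2) pad) auto
    qed (use False s in auto)
    thus ?thesis by (simp add: dirichlet_sum_diff)
  qed (simp add: dirichlet_sum_def harm_def)
  have conv: "convergent (\<lambda>k. dirichlet_sum (d k) N 1)" for N
  proof (cases "N = 0")
    case False
    hence hN: "harm N > (0 :: real)" by simp
    have "Cauchy (\<lambda>k. dirichlet_sum (d k) N 1)"
    proof (rule CauchyI)
      fix e :: real assume e: "e > 0"
      obtain K where K: "\<forall>k\<ge>K. \<forall>s. Re s > 0 \<longrightarrow> norm (dirichlet_sum (c k) (M k) s - f s) \<le> e / (16 * harm N)"
        using approx[of "e / (16 * harm N)"] e hN by auto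
      have "4 * harm N * (2 * (e / (16 * harm N))) < e" using hN e by simp
      with diff[OF K, of _ _ 1 N]
      show "\<exists>K. \<forall>k\<ge>K. \<forall>l\<ge>K. norm (dirichlet_sum (d k) N 1 - dirichlet_sum (d l) N 1) < e"
        by (intro exI[of _ K]) (auto intro: le_less_trans)
    qed
    thus ?thesis by (simp add: Cauchy_convergent_iff)
  qed (simp add: dirichlet_sum_def convergent_const)
  have "convergent (\<lambda>k. d k (Suc n))" for n
  proof -
    have "(\<lambda>k. d k (Suc n)) = (\<lambda>k. (dirichlet_sum (d k) (Suc n) 1 - dirichlet_sum (d k) n 1) * of_nat (Suc n))"
      by (simp add: dirichlet_sum_Suc del: of_nat_Suc)
    thus ?thesis using conv[of "Suc n"] conv[of n]
      by (simp only: convergent_mult convergent_diff convergent_const)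
  qed
  hence "\<exists>a. (\<lambda>k. d k n) \<longlonglongrightarrow> a" if "n \<ge> 1" for n
    using that by (cases n) (auto simp: convergent_def)
  then obtain a where a: "\<And>n. n \<ge> 1 \<Longrightarrow> (\<lambda>k. d k n) \<longlonglongrightarrow> a n"
    by metis
  have sum_lim: "(\<lambda>k. dirichlet_sum (d k) N s) \<longlonglongrightarrow> dirichlet_sum a N s" for N s
    unfolding dirichlet_sum_def divide_inverse by (intro tendsto_sum tendsto_mult a tendsto_const) auto
  have "(\<lambda>N. dirichlet_sum a N s) \<longlonglongrightarrow> f s" if s: "Re s > 0" for s
  proof (rule LIMSEQ_I)
    fix r :: real assume r: "r > 0"
    define \<delta> where "\<delta> = Re s / 2"
    have \<delta>: "\<delta> > 0" using s by (simp add: \<delta>_def)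
    define A where "A = (\<Sum>n. real n powr (-1 - \<delta>))"
    have A: "A \<ge> 0" unfolding A_def using \<delta> by (intro suminf_nonneg) (auto simp: summable_real_powr_iff)
    define e where "e = r / (2 * (8 * A + 1))"
    have e: "e > 0" using r A by (simp add: e_def)
    obtain K where K: "\<forall>k\<ge>K. \<forall>s. Re s > 0 \<longrightarrow> norm (dirichlet_sum (c k) (M k) s - f s) \<le> e"
      using approx[OF e] by auto
    have "norm (dirichlet_sum a N s - f s) < r" if N: "N \<ge> M K" for N
    proof -
      have "norm (dirichlet_sum (d K) N' w - dirichlet_sum a N' w) \<le> 4 * harm N' * (2 * e)"
        if w: "Re w > 0" for N' w
      proof (rule tendsto_upperbound)
        show "(\<lambda>l. norm (dirichlet_sum (d K) N' w - dirichlet_sum (d l) N' w))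
                \<longlonglongrightarrow> norm (dirichlet_sum (d K) N' w - dirichlet_sum a N' w)"
          by (intro tendsto_intros sum_lim)
        show "\<forall>\<^sub>F l in sequentially.
                norm (dirichlet_sum (d K) N' w - dirichlet_sum (d l) N' w) \<le> 4 * harm N' * (2 * e)"
          using eventually_ge_at_top[of K] by eventually_elim (rule diff[OF K _ _ w], auto)
      qed auto
      hence "norm (dirichlet_sum (\<lambda>n. d K n - a n) N (s - of_real \<delta> + of_real \<delta>)) \<le> (8 * e) * A"
        unfolding A_def using s e \<delta> 
        by (intro norm_dirichlet_sum_shift_le) (auto simp: dirichlet_sum_diff \<delta>_def mult_ac)
      hence "norm (dirichlet_sum (c K) (M K) s - dirichlet_sum a N s) \<le> 8 * A * e"
        using N by (simp add: dirichlet_sum_diff pad mult_ac)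
      moreover have "norm (dirichlet_sum (c K) (M K) s - f s) \<le> e" using K s by auto
      ultimately have "norm (dirichlet_sum a N s - f s) \<le> 8 * A * e + e"
        using norm_triangle_ineq4[of "dirichlet_sum (c K) (M K) s - f s"
            "dirichlet_sum (c K) (M K) s - dirichlet_sum a N s"]
        by simp
      also have "8 * A * e + e = (8 * A + 1) * e" by (simp add: algebra_simps)
      also have "\<dots> = r / 2" using A by (simp add: e_def field_simps)
      finally show ?thesis using r by simp
    qed
    thus "\<exists>N0. \<forall>N\<ge>N0. norm (dirichlet_sum a N s - f s) < r" by blast
  qed
  thus ?thesis unfolding dirichlet_series_represents_on_iff by (intro exI[of _ a]) auto
qed

section \<open>Growth of partial sums on vertical lines\<close>

lemma norm_powr_diff_Suc_le:
  assumes n: "n \<ge> 1" and w: "Re w \<ge> 0"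
  shows "norm (of_nat n powr (-w) - of_nat (Suc n) powr (-w) :: complex) \<le> norm w * real n powr (- Re w - 1)"
proof -
  let ?S = "closed_segment (of_nat (Suc n)) (of_nat n :: complex)"
  have S: "\<exists>x. z = of_real x \<and> x \<ge> real n" if z_in: "z \<in> ?S" for z
  proof -
    obtain u where u: "0 \<le> u" "u \<le> 1" and z: "z = (1 - u) *\<^sub>R of_nat (Suc n) + u *\<^sub>R of_nat n"
      using z_in unfolding in_segment by blast
    have "z = of_real (real n + (1 - u))"
      unfolding z by (simp add: scaleR_conv_of_real algebra_simps)
    thus ?thesis using u by (intro exI[of _ "real n + (1 - u)"]) auto
  qed
  have "norm (of_nat n powr (-w) - of_nat (Suc n) powr (-w) :: complex) \<le>
          norm w * real n powr (- Re w - 1) * norm (of_nat n - of_nat (Suc n) :: complex)"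
  proof (rule field_differentiable_bound)
    fix z assume "z \<in> ?S"
    then obtain x where x: "z = of_real x" "x \<ge> real n" using S by blast
    have x0: "x > 0" using x n by linarith
    show "((\<lambda>z. z powr (-w)) has_field_derivative (-w) * z powr (-w - 1)) (at z within ?S)"
      using x x0 by (intro has_field_derivative_at_within[OF has_field_derivative_powr]) auto
    have "norm (z powr (-w - 1)) = x powr (- Re w - 1)"
      using norm_powr_real_powr[of z "-w - 1"] x x0 by simp
    also have "\<dots> \<le> real n powr (- Re w - 1)"
      using n w x by (intro powr_mono2') auto
    finally show "norm ((-w) * z powr (-w - 1)) \<le> norm w * real n powr (- Re w - 1)"
      by (simp add: norm_mult mult_left_mono)
  qed auto
  thus ?thesis by simp
qed

text \<open>
An interpolation between the mean value estimate, of order \<open>|w| / n\<close>, and the trivial bound \<open>2\<close>,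
both relative to \<open>n\<close> to the power \<open>- Re w\<close>. The first is summable in \<open>n\<close> but grows linearly in \<open>|w|\<close>,
the second does the opposite; a power \<open>\<theta>\<close> slightly below \<open>1\<close> keeps summability with sublinear growth.
\<close>
lemma norm_powr_diff_Suc_le_interpolated:
  assumes n: "n \<ge> 1" and w: "Re w \<ge> 0" and \<theta>: "0 \<le> \<theta>" "\<theta> \<le> 1"
  shows "norm (of_nat n powr (-w) - of_nat (Suc n) powr (-w) :: complex) \<le>
           2 * norm w powr \<theta> * real n powr (- Re w - \<theta>)"
proof -
  define x where "x = norm w / real n"
  have x0: "0 \<le> x" by (simp add: x_def)
  have "norm (of_nat n powr (-w) - of_nat (Suc n) powr (-w) :: complex) \<le> real n powr (- Re w) * (2 * x powr \<theta>)"
  proof (cases "x \<le> 1")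
    case True
    have "norm (of_nat n powr (-w) - of_nat (Suc n) powr (-w) :: complex) \<le> norm w * real n powr (- Re w - 1)"
      using n w by (rule norm_powr_diff_Suc_le)
    also have "\<dots> = real n powr (- Re w) * x"
      using n by (simp add: powr_diff x_def)
    also have "x \<le> 2 * x powr \<theta>"
    proof (cases "x = 0")
      case False
      hence "x powr 1 \<le> x powr \<theta>" using True x0 \<theta> by (intro powr_mono') auto
      moreover have "x powr 1 = x" using x0 by simp
      ultimately show ?thesis using x0 by linarith
    qed auto
    finally show ?thesis by (simp add: mult_left_mono)
  next
    case False
    have "norm (of_nat n powr (-w) - of_nat (Suc n) powr (-w) :: complex) \<le>
            norm (of_nat n powr (-w) :: complex) + norm (of_nat (Suc n) powr (-w) :: complex)"
      by (rule norm_triangle_ineq4)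
    also have "\<dots> = real n powr (- Re w) + real (Suc n) powr (- Re w)"
      using n by (simp add: norm_nat_powr del: of_nat_Suc)
    also have "\<dots> \<le> real n powr (- Re w) + real n powr (- Re w)"
      using n w by (intro add_mono order.refl powr_mono2') auto
    also have "\<dots> = real n powr (- Re w) * (2 * 1)" by simp
    also have "\<dots> \<le> real n powr (- Re w) * (2 * x powr \<theta>)"
      using False \<theta> by (intro mult_left_mono ge_one_powr_ge_zero) auto
    finally show ?thesis .
  qed
  also have "\<dots> = 2 * norm w powr \<theta> * real n powr (- Re w - \<theta>)"
    using n by (simp add: x_def powr_divide powr_diff)
  finally show ?thesis .
qed

text \<open>
The series converges slightly to the left of \<open>s\<close>, at \<open>u = s - \<delta>\<close>, so its partial sums there are bounded.
Summation by parts carries this bound to \<open>s + i t\<close>. With \<open>\<theta> = 1 - \<delta> / 2\<close> the differences are of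
order \<open>n\<^sup>-\<^sup>1\<^sup>-\<^sup>\<delta>\<^sup>/\<^sup>2\<close> in \<open>n\<close>. The bound \<open>\<theta> < 1\<close> is essential: against a
kernel of order \<open>t\<^sup>-\<^sup>2\<close> it makes the product integrable.
\<close>
lemma partial_sums_vertical_growth:
  assumes conv: "\<And>s. Re s > 0 \<Longrightarrow> convergent (\<lambda>N. dirichlet_sum c N s)" and s: "Re s > 0"
  obtains C \<theta> where "C \<ge> 0" "0 \<le> \<theta>" "\<theta> < 1"
    "\<And>N t. norm (dirichlet_sum c N (s + \<i> * of_real t)) \<le> C * (1 + \<bar>t\<bar>) powr \<theta>"
proof -
  define \<delta> where "\<delta> = min (Re s / 2) 1"
  have \<delta>: "0 < \<delta>" "\<delta> \<le> 1" "\<delta> < Re s" using s by (auto simp: \<delta>_def)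
  define \<theta> where "\<theta> = 1 - \<delta> / 2"
  have \<theta>: "0 \<le> \<theta>" "\<theta> < 1" using \<delta> by (auto simp: \<theta>_def)
  define u where "u = s - of_real \<delta>"
  have "Bseq (\<lambda>N. dirichlet_sum c N u)"
    using \<delta> by (intro convergent_imp_Bseq conv) (simp add: u_def)
  then obtain B where B: "B > 0" "\<And>N. norm (dirichlet_sum c N u) \<le> B"
    by (auto elim: BseqE)
  define A where "A = (\<Sum>n. real n powr (- 1 - \<delta> / 2))"
  have summ: "summable (\<lambda>n. real n powr (- 1 - \<delta> / 2))" using \<delta> by (simp add: summable_real_powr_iff)
  have A: "A \<ge> 0" unfolding A_def using summ by (intro suminf_nonneg) auto
  have "norm (dirichlet_sum c N (s + \<i> * of_real t)) \<le> B * (1 + 2 * A) * (1 + \<bar>t\<bar>) powr \<theta>" for N t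
  proof -
    define w where "w = of_real \<delta> + \<i> * of_real t"
    define T where "T = (1 + \<bar>t\<bar>) powr \<theta>"
    have Re_w: "Re w = \<delta>" by (simp add: w_def)
    have "norm w \<le> norm (complex_of_real \<delta>) + norm (\<i> * complex_of_real t)"
      unfolding w_def by (rule norm_triangle_ineq)
    also have "\<dots> \<le> 1 + \<bar>t\<bar>" using \<delta> by (simp add: norm_mult)
    finally have "norm w powr \<theta> \<le> T" unfolding T_def using \<theta> by (intro powr_mono2) auto
    have T1: "1 \<le> T" unfolding T_def using \<theta> by (intro ge_one_powr_ge_zero) auto
    have "norm (dirichlet_sum c N (u + w)) \<le> B * norm (of_nat N powr (-w) :: complex) +
            (\<Sum>n=1..<N. B * norm (of_nat n powr (-w) - of_nat (Suc n) powr (-w) :: complex))"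
      unfolding dirichlet_sum_shift by (rule norm_sum_by_parts_le) (use B in \<open>simp add: dirichlet_sum_def\<close>)
    also have "\<dots> \<le> B * T + (\<Sum>n=1..<N. B * (2 * T * real n powr (- 1 - \<delta> / 2)))"
    proof (intro add_mono sum_mono mult_left_mono)
      show "norm (of_nat N powr (-w) :: complex) \<le> T"
      proof (cases "N = 0")
        case False
        hence "real N powr - \<delta> \<le> 1 powr - \<delta>" using \<delta> by (intro powr_mono2') auto
        thus ?thesis using T1 False by (simp add: norm_nat_powr Re_w)
      qed (use T1 in simp)
    next
      fix n assume n: "n \<in> {1..<N}"
      have "norm (of_nat n powr (-w) - of_nat (Suc n) powr (-w) :: complex) \<le>
              2 * norm w powr \<theta> * real n powr (- Re w - \<theta>)"
        using n \<delta> \<theta> by (intro norm_powr_diff_Suc_le_interpolated) (auto simp: Re_w)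
      also have "- Re w - \<theta> = - 1 - \<delta> / 2" by (simp add: Re_w \<theta>_def)
      also have "2 * norm w powr \<theta> * real n powr \<dots> \<le> 2 * T * real n powr \<dots>"
        using \<open>norm w powr \<theta> \<le> T\<close> by (intro mult_right_mono) auto
      finally show "norm (of_nat n powr (-w) - of_nat (Suc n) powr (-w) :: complex) \<le>
                      2 * T * real n powr (- 1 - \<delta> / 2)" .
    qed (use B in auto)
    also have "\<dots> = B * T * (1 + 2 * (\<Sum>n=1..<N. real n powr (- 1 - \<delta> / 2)))"
      by (simp add: sum_distrib_left algebra_simps)
    also have "\<dots> \<le> B * T * (1 + 2 * A)"
      unfolding A_def using B T1 summ by (intro mult_left_mono add_mono sum_le_suminf order.refl) auto
    also have "u + w = s + \<i> * of_real t" by (simp add: u_def w_def)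
    finally show ?thesis by (simp add: T_def mult_ac)
  qed
  moreover have "B * (1 + 2 * A) \<ge> 0" using A B by simp
  ultimately show ?thesis using \<theta> that by blast
qed

section \<open>Boundedness\<close>

text \<open>
Convergence at \<open>s = 1\<close> gives coefficients of order at most \<open>n\<close>, so for \<open>Re s \<ge> 3\<close> the series is
dominated by a multiple of \<open>\<Sum> n\<^sup>-\<^sup>2\<close>.
\<close>
lemma bounded_far_right:
  assumes lim: "\<And>s. Re s > 0 \<Longrightarrow> (\<lambda>N. dirichlet_sum c N s) \<longlonglongrightarrow> f s"
  obtains M where "\<And>s. Re s \<ge> 3 \<Longrightarrow> norm (f s) \<le> M"
proof -
  have "Bseq (\<lambda>N. dirichlet_sum c N 1)"
    by (intro convergent_imp_Bseq convergentI[OF lim]) auto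
  then obtain B where B: "B > 0" "\<And>N. norm (dirichlet_sum c N 1) \<le> B"
    by (auto elim: BseqE)
  have coeff: "norm (c n) \<le> 2 * B * real n" if "n \<ge> 1" for n
  proof -
    obtain m where m: "n = Suc m" using \<open>n \<ge> 1\<close> by (cases n) auto
    have "c n / of_nat n = dirichlet_sum c n 1 - dirichlet_sum c m 1"
      using m by (simp add: dirichlet_sum_Suc del: of_nat_Suc)
    hence "norm (c n / of_nat n) \<le> B + B"
      using norm_triangle_ineq4[of "dirichlet_sum c n 1" "dirichlet_sum c m 1"] B(2)[of n] B(2)[of m] by simp
    thus ?thesis using that by (simp add: norm_divide pos_divide_le_eq)
  qed
  define A where "A = (\<Sum>n. real n powr -2)"
  have "norm (dirichlet_sum c N s) \<le> 2 * B * A" if s: "Re s \<ge> 3" for N s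
  proof -
    have "norm (dirichlet_sum c N s) \<le> (\<Sum>n=1..N. 2 * B * real n powr -2)"
      unfolding dirichlet_sum_def
    proof (rule sum_norm_le)
      fix n assume n: "n \<in> {1..N}"
      have "norm (c n / of_nat n powr s) \<le> 2 * B * real n / real n powr 3"
        using n s B coeff[of n] powr_mono[of 3 "Re s" "real n"]
        by (auto simp: norm_divide norm_nat_powr intro!: frac_le)
      also have "\<dots> = 2 * B * (real n powr 1 / real n powr 3)" using n by simp
      also have "real n powr 1 / real n powr 3 = real n powr -2"
        using powr_diff[of "real n" 1 3] by simp
      finally show "norm (c n / of_nat n powr s) \<le> 2 * B * real n powr -2" .
    qed
    also have "\<dots> = 2 * B * (\<Sum>n=1..N. real n powr -2)" by (simp add: sum_distrib_left)
    also have "\<dots> \<le> 2 * B * A"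
      unfolding A_def using B by (intro mult_left_mono sum_le_suminf) (auto simp: summable_real_powr_iff)
    finally show ?thesis .
  qed
  hence "norm (f s) \<le> 2 * B * A" if "Re s \<ge> 3" for s
    using that by (intro tendsto_upperbound[OF tendsto_norm[OF lim]]) auto
  thus ?thesis using that by blast
qed

text \<open>
Every point reaches \<open>Re s \<ge> 3\<close> by the same number of short horizontal steps, and uniform continuity
bounds the change of \<open>f\<close> in each step by \<open>1\<close>.
\<close>
lemma bounded_of_bounded_far_right:
  assumes uc: "uniformly_continuous_on right_half_plane f" and far: "\<And>s. Re s \<ge> 3 \<Longrightarrow> norm (f s) \<le> M"
  obtains M' where "\<And>s. Re s > 0 \<Longrightarrow> norm (f s) \<le> M'"
proof -
  obtain d where d: "d > 0" "\<And>s w. Re s > 0 \<Longrightarrow> Re w > 0 \<Longrightarrow> dist w s < d \<Longrightarrow> dist (f w) (f s) < 1"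
    using uc unfolding uniformly_continuous_on_def by (metis mem_right_half_plane zero_less_one)
  define h where "h = d / 2"
  have h: "0 < h" "h < d" using d by (auto simp: h_def)
  have step: "norm (f s) \<le> norm (f (s + of_real (h * real m))) + real m" if "Re s > 0" for s m
  proof (induction m)
    case (Suc m)
    let ?s = "s + of_real (h * real m)" and ?s' = "s + of_real (h * real (Suc m))"
    have "?s - ?s' = - of_real h" by (simp add: algebra_simps)
    hence "dist ?s ?s' < d" using h by (simp add: dist_norm)
    moreover have "Re ?s > 0" "Re ?s' > 0" using that h by (auto intro!: add_pos_nonneg)
    ultimately have "dist (f ?s) (f ?s') < 1" by (intro d)
    hence "norm (f ?s) \<le> norm (f ?s') + 1"
      using norm_triangle_ineq2[of "f ?s" "f ?s'"] by (simp add: dist_norm)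
    with Suc.IH show ?case by simp
  qed simp
  obtain m where m: "3 / h \<le> real m" using real_arch_simple by blast
  have "norm (f s) \<le> M + real m" if s: "Re s > 0" for s
  proof -
    have "3 \<le> h * real m" using m h by (simp add: field_simps)
    hence "norm (f (s + of_real (h * real m))) \<le> M" using s by (intro far) simp
    thus ?thesis using step[OF s, of m] by simp
  qed
  thus ?thesis using that by blast
qed

section \<open>Fejer averages of a Dirichlet series\<close>

text \<open>
The averages of the partial sums of length \<open>k\<close> are constant once \<open>k \<ge> N\<close>, because the trapezoid vanishes
beyond the frequency \<open>R\<close>. Dominated convergence identifies this constant with the average of \<open>f\<close>.
\<close>
lemma has_integral_fejer_average:
  assumes lim: "\<And>s. Re s > 0 \<Longrightarrow> (\<lambda>N. dirichlet_sum c N s) \<longlonglongrightarrow> f s"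
    and R: "R > 0" and N: "R \<le> ln (real N + 1)" and s: "Re s > 0"
  shows "((\<lambda>t. of_real (trapezoid_kernel 0 R t) * vertical_pair f s t) has_integral
           dirichlet_sum (\<lambda>n. of_real (trapezoid 0 R (ln n)) * c n) N s) {0..}"
proof -
  let ?K = "trapezoid_kernel 0 R"
  define I where "I = dirichlet_sum (\<lambda>n. of_real (trapezoid 0 R (ln n)) * c n)"
  obtain C \<theta> where C: "C \<ge> 0" and \<theta>: "0 \<le> \<theta>" "\<theta> < 1" and
    growth: "\<And>N t. norm (dirichlet_sum c N (s + \<i> * of_real t)) \<le> C * (1 + \<bar>t\<bar>) powr \<theta>"
    using partial_sums_vertical_growth[OF convergentI[OF lim] s] by blast
  have I_const: "I k s = I N s" if "k \<ge> N" for k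
  proof -
    have zero: "trapezoid 0 R (ln n) = 0" if "n > N" for n :: nat
    proof -
      have "R \<le> ln (real n)" using that by (intro order.trans[OF N]) auto
      thus ?thesis using R by (intro trapezoid_eq_0) auto
    qed
    show ?thesis
      unfolding I_def dirichlet_sum_def using that zero by (intro sum.mono_neutral_right) auto
  qed
  have int: "((\<lambda>t. of_real (?K t) * vertical_pair (dirichlet_sum c k) s t) has_integral I k s) {0..}" for k
    unfolding I_def by (rule has_integral_trapezoid_kernel_dirichlet_sum[OF R])
  define h where "h = (\<lambda>t. if t \<le> 1 then R / (2 * pi) * (4 * C) else 2 / (R * pi) * (4 * C) * t powr (\<theta> - 2))"
  have h: "h integrable_on {0..}"
  proof (rule integrable_Un')
    show "h integrable_on {0..1}"
      by (rule integrable_eq[of "\<lambda>_. R / (2 * pi) * (4 * C)"]) (auto simp: h_def)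
    have "(\<lambda>t. 2 / (R * pi) * (4 * C) * t powr (\<theta> - 2)) integrable_on {1..}"
      using \<theta> by (intro integrable_on_mult_right has_integral_integrable[OF has_integral_powr_to_inf]) auto
    thus "h integrable_on {1..}"
      by (rule integrable_spike_finite[of "{1}", rotated 2]) (auto simp: h_def)
    have "{0..1} \<inter> {1..} \<subseteq> {1 :: real}" by auto
    thus "negligible ({0..1} \<inter> {1 :: real..})" using negligible_subset negligible_sing by blast
  qed auto
  have dom: "norm (of_real (?K t) * vertical_pair (dirichlet_sum c k) s t) \<le> h t" if t: "t \<in> {0..}" for k t
  proof -
    have "norm (vertical_pair (dirichlet_sum c k) s t) \<le> 2 * (C * (1 + t) powr \<theta>)"
      using norm_triangle_ineq[of "dirichlet_sum c k (s + \<i> * t)" "dirichlet_sum c k (s - \<i> * t)"]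
        growth[of k t] growth[of k "-t"] t by (simp add: vertical_pair_def)
    also have "(1 + t) powr \<theta> \<le> (2 * max 1 t) powr \<theta>" using t \<theta> by (intro powr_mono2) auto
    also have "\<dots> = 2 powr \<theta> * max 1 t powr \<theta>" by (rule powr_mult)
    also have "\<dots> \<le> 2 * max 1 t powr \<theta>" using \<theta> powr_mono[of \<theta> 1 2] by (intro mult_right_mono) auto
    finally have v: "norm (vertical_pair (dirichlet_sum c k) s t) \<le> 4 * C * max 1 t powr \<theta>"
      using C by (simp add: mult_left_mono)
    show ?thesis
    proof (cases "t \<le> 1")
      case True
      have "\<bar>?K t\<bar> * norm (vertical_pair (dirichlet_sum c k) s t) \<le> R / (2 * pi) * (4 * C)"
        using abs_trapezoid_kernel_le(1)[of 0 R t] v t True R by (intro mult_mono) auto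
      thus ?thesis using True by (simp add: h_def norm_mult)
    next
      case False
      have "\<bar>?K t\<bar> * norm (vertical_pair (dirichlet_sum c k) s t) \<le> 2 / (R * pi * t\<^sup>2) * (4 * C * t powr \<theta>)"
        using abs_trapezoid_kernel_le(3)[of 0 R t] v t False R by (intro mult_mono) auto
      also have "\<dots> = 2 / (R * pi) * (4 * C) * t powr (\<theta> - 2)"
        using False by (simp add: powr_diff)
      finally show ?thesis using False by (simp add: h_def norm_mult)
    qed
  qed
  have conv: "(\<lambda>k. of_real (?K t) * vertical_pair (dirichlet_sum c k) s t) \<longlonglongrightarrow>
                of_real (?K t) * vertical_pair f s t" for t
    unfolding vertical_pair_def using s by (intro tendsto_intros lim) auto
  note dc = dominated_convergence[OF has_integral_integrable[OF int] h dom conv]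
  have "(\<lambda>k. I k s) \<longlonglongrightarrow> integral {0..} (\<lambda>t. of_real (?K t) * vertical_pair f s t)"
    using dc(2) by (simp add: integral_unique[OF int])
  moreover have "(\<lambda>k. I k s) \<longlonglongrightarrow> I N s"
    using I_const by (intro tendsto_eventually eventually_sequentiallyI[of N])
  ultimately have "integral {0..} (\<lambda>t. of_real (?K t) * vertical_pair f s t) = I N s"
    by (rule LIMSEQ_unique)
  with dc(1) show ?thesis unfolding I_def by (simp add: has_integral_integrable_integral)
qed

text \<open>
The usual approximate identity argument: the kernel is nonnegative with total mass \<open>1\<close> (in the
paired form \<open>2 K\<close> on the half-line). The oscillation bound controls the part \<open>t < \<eta>\<close>, and boundedness of \<open>f\<close>
together with the decay \<open>K(t) \<le> 2 / (\<pi> R t\<^sup>2)\<close> controls the rest.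
\<close>
lemma norm_fejer_average_diff_le:
  assumes int: "((\<lambda>t. of_real (trapezoid_kernel 0 R t) * vertical_pair f s t) has_integral I) {0..}"
    and R: "R > 0" and \<eta>: "\<eta> > 0" and s: "Re s > 0"
    and M: "\<And>s. Re s > 0 \<Longrightarrow> norm (f s) \<le> M"
    and osc: "\<And>t. \<bar>t\<bar> < \<eta> \<Longrightarrow> norm (f (s + \<i> * of_real t) - f s) \<le> e"
  shows "norm (I - f s) \<le> e + 8 * M / (pi * R * \<eta>)"
proof -
  let ?K = "trapezoid_kernel 0 R"
  have e: "0 \<le> e" using osc[of 0] \<eta> by simp
  have M0: "0 \<le> M" by (rule order.trans[OF norm_ge_zero M[OF s]])
  have K0: "0 \<le> ?K t" for t using R by (simp add: trapezoid_kernel_def)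
  have mass: "((\<lambda>t. 2 * ?K t) has_integral 1) {0..}"
    using has_integral_trapezoid_kernel_cos[of 0 R 0] R by (simp add: trapezoid_eq_1)
  have "((\<lambda>t. of_real (2 * ?K t) * f s) has_integral of_real 1 * f s) {0..}"
    by (intro has_integral_mult_left has_integral_of_real mass)
  from has_integral_diff[OF int this]
  have diff: "((\<lambda>t. of_real (?K t) * (vertical_pair f s t - 2 * f s)) has_integral I - f s) {0..}"
    by (simp add: algebra_simps)
  define h where "h = (\<lambda>t. e * (2 * ?K t) + (if t \<in> {\<eta>..} then 8 * M / (pi * R) * (1 / t\<^sup>2) else 0))"
  have "((\<lambda>t. 8 * M / (pi * R) * (1 / t\<^sup>2)) has_integral
          8 * M / (pi * R) * (1 / (real (2 - 1) * \<eta> ^ (2 - 1)))) {\<eta>..}"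
    using \<eta> by (intro has_integral_mult_right has_integral_inverse_power_to_inf) auto
  hence h: "(h has_integral e * 1 + 8 * M / (pi * R) * (1 / (real (2 - 1) * \<eta> ^ (2 - 1)))) {0..}"
    unfolding h_def using \<eta> by (intro has_integral_add has_integral_mult_right mass)
      (subst has_integral_restrict, auto)
  have "norm (integral {0..} (\<lambda>t. of_real (?K t) * (vertical_pair f s t - 2 * f s))) \<le> integral {0..} h"
  proof (rule Henstock_Kurzweil_Integration.integral_norm_bound_integral)
    fix t :: real assume t: "t \<in> {0..}"
    have split: "vertical_pair f s t - 2 * f s = (f (s + \<i> * t) - f s) + (f (s - \<i> * t) - f s)"
      by (simp add: vertical_pair_def)
    show "norm (of_real (?K t) * (vertical_pair f s t - 2 * f s)) \<le> h t"
    proof (cases "t < \<eta>")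
      case True
      have "norm (vertical_pair f s t - 2 * f s) \<le> 2 * e"
        unfolding split using osc[of t] osc[of "-t"] True t by (intro order.trans[OF norm_triangle_ineq]) auto
      hence "?K t * norm (vertical_pair f s t - 2 * f s) \<le> ?K t * (2 * e)"
        by (intro mult_left_mono K0)
      thus ?thesis using True K0 by (simp add: h_def norm_mult mult_ac)
    next
      case False
      have "norm (vertical_pair f s t - 2 * f s) \<le> 4 * M"
        unfolding split using M[of "s + \<i> * t"] M[of "s - \<i> * t"] M[of s] s
          norm_triangle_ineq4[of "f (s + \<i> * t)" "f s"] norm_triangle_ineq4[of "f (s - \<i> * t)" "f s"]
        by (intro order.trans[OF norm_triangle_ineq]) auto
      moreover have "?K t \<le> 2 / (R * pi * t\<^sup>2)"
        using abs_trapezoid_kernel_le(3)[of 0 R t] R t by simp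
      ultimately have "?K t * norm (vertical_pair f s t - 2 * f s) \<le> 2 / (R * pi * t\<^sup>2) * (4 * M)"
        using R by (intro mult_mono) auto
      moreover have "0 \<le> e * (2 * ?K t)" using e K0 by simp
      ultimately show ?thesis using False K0 by (simp add: h_def norm_mult mult_ac)
    qed
  qed (use diff h in \<open>auto simp: integrable_on_def\<close>)
  thus ?thesis unfolding integral_unique[OF diff] integral_unique[OF h] by (simp add: mult_ac)
qed

text \<open>
The estimate \<open>norm_fejer_average_diff_le\<close> depends on \<open>s\<close> only through the modulus of
continuity and the supremum of \<open>f\<close>, which are the same for the whole half-plane.
\<close>
lemma fejer_averages_converge_uniformly:
  assumes lim: "\<And>s. Re s > 0 \<Longrightarrow> (\<lambda>N. dirichlet_sum c N s) \<longlonglongrightarrow> f s"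
    and uc: "uniformly_continuous_on right_half_plane f"
    and N: "\<And>k. real (Suc k) \<le> ln (real (N k) + 1)"
  shows "uniform_limit right_half_plane
           (\<lambda>k. dirichlet_sum (\<lambda>n. of_real (trapezoid 0 (Suc k) (ln n)) * c n) (N k)) f sequentially"
proof (rule uniform_limitI)
  fix e :: real assume e: "e > 0"
  obtain M where M: "\<And>s. Re s > 0 \<Longrightarrow> norm (f s) \<le> M"
    using bounded_far_right[OF lim] bounded_of_bounded_far_right[OF uc] by metis
  have M0: "0 \<le> M" by (rule order.trans[OF norm_ge_zero M[of 1]]) simp
  have "e / 2 > 0" using e by simp
  then obtain \<eta> where \<eta>: "\<eta> > 0" and osc: "\<And>s w. s \<in> right_half_plane \<Longrightarrow> w \<in> right_half_plane \<Longrightarrow>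
      dist w s < \<eta> \<Longrightarrow> dist (f w) (f s) < e / 2"
    using uc unfolding uniformly_continuous_on_def by blast
  have "(\<lambda>k. 8 * M / (pi * \<eta>) * inverse (real (Suc k))) \<longlonglongrightarrow> 8 * M / (pi * \<eta>) * 0"
    by (intro tendsto_mult tendsto_const LIMSEQ_inverse_real_of_nat)
  hence "\<forall>\<^sub>F k in sequentially. 8 * M / (pi * \<eta>) * inverse (real (Suc k)) < e / 2"
    using e by (intro order_tendstoD) auto
  thus "\<forall>\<^sub>F k in sequentially. \<forall>s\<in>right_half_plane.
          dist (dirichlet_sum (\<lambda>n. of_real (trapezoid 0 (Suc k) (ln n)) * c n) (N k) s) (f s) < e"
  proof eventually_elim
    case (elim k)
    show ?case
    proof
      fix s :: complex assume "s \<in> right_half_plane"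
      hence s: "Re s > 0" by simp
      have int: "((\<lambda>t. of_real (trapezoid_kernel 0 (Suc k) t) * vertical_pair f s t) has_integral
           dirichlet_sum (\<lambda>n. of_real (trapezoid 0 (Suc k) (ln n)) * c n) (N k) s) {0..}"
        by (rule has_integral_fejer_average[OF lim _ N s]) auto
      have "norm (f (s + \<i> * of_real t) - f s) \<le> e / 2" if "\<bar>t\<bar> < \<eta>" for t
        using osc[of s "s + \<i> * of_real t"] s that by (simp add: dist_norm norm_mult)
      from norm_fejer_average_diff_le[OF int _ \<eta> s M this]
      have "dist (dirichlet_sum (\<lambda>n. of_real (trapezoid 0 (Suc k) (ln n)) * c n) (N k) s) (f s) \<le>
              e / 2 + 8 * M / (pi * real (Suc k) * \<eta>)"
        by (simp add: dist_norm)
      also have "8 * M / (pi * real (Suc k) * \<eta>) = 8 * M / (pi * \<eta>) * inverse (real (Suc k))"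
        by (simp add: field_simps)
      finally show "dist (dirichlet_sum (\<lambda>n. of_real (trapezoid 0 (Suc k) (ln n)) * c n) (N k) s) (f s) < e"
        using elim by simp
    qed
  qed
qed

section \<open>The equivalence\<close>

theorem theorem2p3:
  fixes f :: "complex \<Rightarrow> complex"
  shows "(\<exists>P :: nat \<Rightarrow> complex \<Rightarrow> complex.
            (\<forall>k. dirichlet_polynomial (P k)) \<and>
            uniform_limit right_half_plane P f sequentially)
         \<longleftrightarrow>
         ((\<exists>a :: nat \<Rightarrow> complex. dirichlet_series_represents_on a right_half_plane f) \<and>
          uniformly_continuous_on right_half_plane f)"
proof
  assume "\<exists>P. (\<forall>k. dirichlet_polynomial (P k)) \<and> uniform_limit right_half_plane P f sequentially"
  then obtain P where poly: "\<And>k. dirichlet_polynomial (P k)"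
    and lim: "uniform_limit right_half_plane P f sequentially"
    by blast
  obtain N c where P: "\<And>k. P k = dirichlet_sum (c k) (N k)"
    using poly unfolding dirichlet_polynomial_iff by metis
  have lim': "uniform_limit right_half_plane (\<lambda>k. dirichlet_sum (c k) (N k)) f sequentially"
    using lim by (simp add: P[abs_def])
  show "(\<exists>a. dirichlet_series_represents_on a right_half_plane f) \<and> uniformly_continuous_on right_half_plane f"
    using uniform_limit_dirichlet_sums_represented[OF lim']
      uniformly_continuous_on_uniform_limit[OF uniformly_continuous_on_dirichlet_sum lim'] by blast
next
  assume "(\<exists>a. dirichlet_series_represents_on a right_half_plane f) \<and> uniformly_continuous_on right_half_plane f"
  then obtain a where "dirichlet_series_represents_on a right_half_plane f"
    and uc: "uniformly_continuous_on right_half_plane f" by blast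
  hence lim: "(\<lambda>N. dirichlet_sum a N s) \<longlonglongrightarrow> f s" if "Re s > 0" for s
    using that by (simp add: dirichlet_series_represents_on_iff)
  define N where "N = (\<lambda>k. nat \<lceil>exp (real (Suc k))\<rceil>)"
  have "real (Suc k) \<le> ln (real (N k) + 1)" for k
  proof -
    have "exp (real (Suc k)) \<le> real (N k) + 1" unfolding N_def by linarith
    moreover have "0 < real (N k) + 1" by simp
    ultimately show ?thesis by (subst ln_ge_iff)
  qed
  from fejer_averages_converge_uniformly[OF lim uc this]
  show "\<exists>P. (\<forall>k. dirichlet_polynomial (P k)) \<and> uniform_limit right_half_plane P f sequentially"
    by (intro exI[of _ "\<lambda>k. dirichlet_sum (\<lambda>n. of_real (trapezoid 0 (Suc k) (ln n)) * a n) (N k)"])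
       (auto simp: dirichlet_polynomial_iff)
qed

end
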